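(* Let $q$ be an even prime power. In the hyperbolic plane of order $q$ there exists a blocking set $X$ (a set of points meeting every line) of size $$|X|\le\left\lceil \frac{q(q-1)}{2}-\sqrt[q/2]{\binom{q(q-1)/2}{q/2}\frac{(q/2)!}{q^2-1}}\right\rceil.$$
   Context: The hyperbolic plane of even order $q$ is the following incidence structure. Fix $\gamma\in\mathbb{F}_q$ with $t^2+t+\gamma$ irreducible over $\mathbb{F}_q$, let $\mathcal{O}\subset\mathbb{P}^3$ be the quadric $xw-y^2-yz-\gamma z^2=0$. A circle is the intersection of $\mathcal{O}$ with a plane defined over $\mathbb{F}_q$ and not tangent to $\mathcal{O}$. Let $*$ be the involution $(x:y:z:w)^*=(w:y:z:x)$, which preserves $\mathcal{O}$, and let $B$ be the circle cut out by $x+w=0$ (pointwise fixed by $*$ since $q$ is even). Points of the hyperbolic plane are the pairs $\{P,P^*\}$ with $P\in\mathcal{O}(\mathbb{F}_q)\setminus B$; lines are the circles other than $B$ cut out by linear forms $\ell$ with $\ell(x,y,z,w)=\ell(w,y,z,x)$; incidence is containment. It has $q(q-1)/2$ points and $q^2-1$ lines, $q/2$ points on each line, $q+1$ lines through each point, and any two distinct points lie on a unique line. *)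

theory Defs
  imports
    "HOL-Analysis.Cartesian_Space"
    "HOL-Computational_Algebra.Polynomial"
    "HOL-Number_Theory.Prime_Powers"
begin

text \<open>
  Points of the projective space \<open>\<P>\<^sup>3\<close> over \<^typ>\<open>'a\<close> are the one-dimensional subspaces of
  \<open>'a ^ 4\<close>. Homogeneous coordinates \<open>(x : y : z : w)\<close> are the components \<open>1, 2, 3, 4\<close>.
\<close>

definition proj_points :: "('a::field ^ 4) set set" where
  "proj_points = {vec.span {v} | v. v \<noteq> 0}"

definition linear_form :: "('a::field ^ 4 \<Rightarrow> 'a) \<Rightarrow> bool" where
  "linear_form l \<longleftrightarrow> Vector_Spaces.linear (*s) (*) l"

definition zero_locus :: "('a::field ^ 4 \<Rightarrow> 'a) \<Rightarrow> ('a ^ 4) set set" where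
  "zero_locus f = {P \<in> proj_points. \<forall>v\<in>P. f v = 0}"

definition quadric_form :: "'a::field \<Rightarrow> 'a ^ 4 \<Rightarrow> 'a" where
  "quadric_form \<gamma> v = v$1 * v$4 - (v$2)^2 - v$2 * v$3 - \<gamma> * (v$3)^2"

definition quadric :: "'a::field \<Rightarrow> ('a ^ 4) set set" where
  "quadric \<gamma> = zero_locus (quadric_form \<gamma>)"

text \<open>
  The differential of \<^const>\<open>quadric_form\<close> at \<open>u\<close>, applied to \<open>v\<close>; the coefficients are the formal
  partial derivatives of \<open>x w - y\<^sup>2 - y z - \<gamma> z\<^sup>2\<close>.
\<close>

definition quadric_diff :: "'a::field \<Rightarrow> 'a ^ 4 \<Rightarrow> 'a ^ 4 \<Rightarrow> 'a" where
  "quadric_diff \<gamma> u v =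
     u$4 * v$1 - (2 * u$2 + u$3) * v$2 - (u$2 + 2 * \<gamma> * u$3) * v$3 + u$1 * v$4"

definition tangent_plane :: "'a::field \<Rightarrow> ('a ^ 4) set \<Rightarrow> ('a ^ 4) set set" where
  "tangent_plane \<gamma> P = {R \<in> proj_points. \<forall>u\<in>P. \<forall>v\<in>R. quadric_diff \<gamma> u v = 0}"

text \<open>
  Only rational points of tangency are considered. This loses nothing: the quadric is smooth and
  its tangent planes at distinct points over the algebraic closure are distinct, so the point of
  tangency of a rational plane is fixed by Galois and hence rational.
\<close>

definition tangent_to_quadric :: "'a::field \<Rightarrow> ('a ^ 4) set set \<Rightarrow> bool" where
  "tangent_to_quadric \<gamma> H \<longleftrightarrow> (\<exists>P\<in>quadric \<gamma>. H = tangent_plane \<gamma> P)"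

definition circles :: "'a::field \<Rightarrow> ('a ^ 4) set set set" where
  "circles \<gamma> = {quadric \<gamma> \<inter> zero_locus l | l.
     linear_form l \<and> l \<noteq> (\<lambda>v. 0) \<and> \<not> tangent_to_quadric \<gamma> (zero_locus l)}"

definition swap_xw :: "'a::field ^ 4 \<Rightarrow> 'a ^ 4" where
  "swap_xw v = vector [v$4, v$2, v$3, v$1]"

definition star :: "('a::field ^ 4) set \<Rightarrow> ('a ^ 4) set" where
  "star P = swap_xw ` P"

definition base_circle :: "'a::field \<Rightarrow> ('a ^ 4) set set" where
  "base_circle \<gamma> = quadric \<gamma> \<inter> zero_locus (\<lambda>v. v$1 + v$4)"

definition hyp_points :: "'a::field \<Rightarrow> ('a ^ 4) set set set" where
  "hyp_points \<gamma> = {{P, star P} | P. P \<in> quadric \<gamma> - base_circle \<gamma>}"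

definition hyp_lines :: "'a::field \<Rightarrow> ('a ^ 4) set set set" where
  "hyp_lines \<gamma> = {C \<in> circles \<gamma>. C \<noteq> base_circle \<gamma> \<and>
     (\<exists>l. linear_form l \<and> l \<noteq> (\<lambda>v. 0) \<and> (\<forall>v. l (swap_xw v) = l v) \<and>
          C = quadric \<gamma> \<inter> zero_locus l)}"

text \<open>
  Hyperbolic points are pairs of points of \<open>\<P>\<^sup>3\<close> and hyperbolic lines are sets of points of \<open>\<P>\<^sup>3\<close>, so
  incidence is \<open>\<subseteq>\<close>.
\<close>

definition blocking_set :: "'a::field \<Rightarrow> ('a ^ 4) set set set \<Rightarrow> bool" where
  "blocking_set \<gamma> X \<longleftrightarrow> X \<subseteq> hyp_points \<gamma> \<and> (\<forall>L\<in>hyp_lines \<gamma>. \<exists>p\<in>X. p \<subseteq> L)"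

end

theory Submission
  imports Defs "HOL-Number_Theory.Residues"
begin

text \<open>
  Counting \<open>t\<close>-subsets: if the complement of no \<open>t\<close>-set of points blocks all \<open>m\<close> lines, each of
  size at least \<open>k\<close>, then \<open>(n choose k) \<le> m (t choose k)\<close>, and \<open>(t choose k) k! < t^k\<close> for \<open>k \<ge> 2\<close>
  contradicts the choice of \<open>t\<close> as the rounded-down root. The parameters of the plane come from
  explicit parametrizations in the chart \<open>x + w = 1\<close>, where the involution is \<open>x \<mapsto> x + 1\<close>, points are
  the orbits of solutions of \<open>x\<^sup>2 + x = y\<^sup>2 + y z + \<gamma> z\<^sup>2\<close>, and invariant planes are
  \<open>a + b y + c z = 0\<close>.
\<close>

section \<open>Counting subsets and rounding the root\<close>

text \<open>A union bound. If the complement of a \<open>t\<close>-set misses \<open>L i\<close>,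
  the \<open>t\<close>-set contains \<open>L i\<close> and hence any \<open>k\<close>-subset of it.
  A fixed \<open>k\<close>-subset lies in only \<open>(card P - k) choose (t - k)\<close> of the
  \<open>t\<close>-sets, so \<open>card I\<close> of them cannot account for all
  \<open>t\<close>-sets.\<close>

lemma blocking_set_exists:
  fixes P :: "'p set" and I :: "'i set" and L :: "'i \<Rightarrow> 'p set"
  assumes finP: "finite P" and finI: "finite I" and t: "t \<le> card P"
    and L: "\<And>i. i \<in> I \<Longrightarrow> L i \<subseteq> P" "\<And>i. i \<in> I \<Longrightarrow> k \<le> card (L i)"
    and bound: "card I * (t choose k) < card P choose k"
  shows "\<exists>X\<subseteq>P. card X = card P - t \<and> (\<forall>i\<in>I. X \<inter> L i \<noteq> {})"
proof (rule ccontr)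
  assume neg: "\<not> ?thesis"
  define A where "A = {Y. Y \<subseteq> P \<and> card Y = t}"
  have bad: "\<exists>i\<in>I. L i \<subseteq> Y" if "Y \<in> A" for Y
  proof (rule ccontr)
    assume no: "\<not> ?thesis"
    have Y: "Y \<subseteq> P" "card Y = t" using that by (auto simp: A_def)
    have "card (P - Y) = card P - t"
      using Y finP by (simp add: card_Diff_subset finite_subset)
    moreover have "(P - Y) \<inter> L i \<noteq> {}" if "i \<in> I" for i
      using no L(1) that by blast
    ultimately show False using neg by blast
  qed
  \<comment> \<open>\<open>L i\<close> may have more than \<open>k\<close> elements; fixing a subset
    of exactly \<open>k\<close> makes the count of its supersets exact.\<close>
  define M where "M i = (SOME S. S \<subseteq> L i \<and> card S = k)" for i
  have M: "M i \<subseteq> L i" "card (M i) = k" if "i \<in> I" for i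
  proof -
    have "\<exists>S. S \<subseteq> L i \<and> card S = k"
      using obtain_subset_with_card_n[OF L(2)[OF that]] by metis
    from someI_ex[OF this] show "M i \<subseteq> L i" "card (M i) = k" by (auto simp: M_def)
  qed
  have finA: "finite A" using finP by (simp add: A_def)
  have cardA: "card A = card P choose t" by (simp add: A_def n_subsets finP)
  have containing: "card {Y \<in> A. M i \<subseteq> Y} = (card P - k) choose (t - k)" if i: "i \<in> I" and kt: "k \<le> t" for i
  proof -
    have MP: "M i \<subseteq> P" "finite (M i)" using M(1)[OF i] L(1)[OF i] finP by (auto intro: finite_subset)
    have "bij_betw (\<lambda>Z. Z \<union> M i) {Z. Z \<subseteq> P - M i \<and> card Z = t - k} {Y \<in> A. M i \<subseteq> Y}"
    proof (rule bij_betwI[where g = "\<lambda>Y. Y - M i"], goal_cases)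
      case 1
      show ?case
      proof (intro Pi_I)
        fix Z assume "Z \<in> {Z. Z \<subseteq> P - M i \<and> card Z = t - k}"
        hence Z: "Z \<subseteq> P - M i" "card Z = t - k" by auto
        have "finite Z" using Z(1) finP by (auto intro: finite_subset)
        hence "card (Z \<union> M i) = t"
          using Z MP kt M(2)[OF i] by (subst card_Un_disjoint) auto
        thus "Z \<union> M i \<in> {Y \<in> A. M i \<subseteq> Y}" using Z MP by (auto simp: A_def)
      qed
    next
      case 2
      show ?case
      proof (intro Pi_I)
        fix Y assume "Y \<in> {Y \<in> A. M i \<subseteq> Y}"
        hence Y: "Y \<subseteq> P" "card Y = t" "M i \<subseteq> Y" by (auto simp: A_def)
        hence "card (Y - M i) = t - k" using MP M(2)[OF i] by (simp add: card_Diff_subset)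
        thus "Y - M i \<in> {Z. Z \<subseteq> P - M i \<and> card Z = t - k}" using Y by blast
      qed
    next
      case (3 Z)
      thus ?case by blast
    next
      case (4 Y)
      thus ?case by blast
    qed
    hence "card {Y \<in> A. M i \<subseteq> Y} = card {Z. Z \<subseteq> P - M i \<and> card Z = t - k}"
      by (simp add: bij_betw_same_card)
    also have "\<dots> = (card P - k) choose (t - k)"
      using MP finP M(2)[OF i] by (simp add: n_subsets card_Diff_subset)
    finally show ?thesis .
  qed
  have cover: "A \<subseteq> (\<Union>i\<in>I. {Y \<in> A. M i \<subseteq> Y})"
  proof
    fix Y assume Y: "Y \<in> A"
    then obtain i where "i \<in> I" "L i \<subseteq> Y" using bad by blast
    thus "Y \<in> (\<Union>i\<in>I. {Y \<in> A. M i \<subseteq> Y})" using M(1)[of i] Y by auto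
  qed
  \<comment> \<open>This rules out truncation in \<open>t - k\<close>: some \<open>t\<close>-set
    exists, and it contains an \<open>L i\<close> with at least \<open>k\<close> elements.\<close>
  have kt: "k \<le> t"
  proof -
    obtain Y where Y: "Y \<subseteq> P" "card Y = t" using obtain_subset_with_card_n[OF t] by metis
    then obtain i where i: "i \<in> I" "L i \<subseteq> Y" using bad[of Y] by (auto simp: A_def)
    have "card (L i) \<le> t" 
      using card_mono[OF finite_subset[OF Y(1) finP] i(2)] Y(2) by simp
    thus ?thesis using L(2)[OF i(1)] by simp
  qed
  have "card P choose t \<le> card (\<Union>i\<in>I. {Y \<in> A. M i \<subseteq> Y})"
    unfolding cardA[symmetric] by (intro card_mono cover) (auto simp: finI finA)
  also have "\<dots> \<le> (\<Sum>i\<in>I. card {Y \<in> A. M i \<subseteq> Y})" by (rule card_UN_le[OF finI])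
  also have "\<dots> = card I * ((card P - k) choose (t - k))" by (simp add: containing kt)
  \<comment> \<open>The factor \<open>t choose k\<close> prepares \<open>choose_mult\<close>, which
    turns the left side into \<open>(card P choose k) * ((card P - k) choose (t - k))\<close>; the
    second factor then cancels.\<close>
  finally have "(card P choose t) * (t choose k) \<le> card I * ((card P - k) choose (t - k)) * (t choose k)"
    by (rule mult_le_mono1)
  hence "(card P choose k) * ((card P - k) choose (t - k)) \<le> card I * (t choose k) * ((card P - k) choose (t - k))"
    unfolding choose_mult[OF kt t] by (simp only: mult_ac)
  moreover have "(card P - k) choose (t - k) > 0" using t kt by simp
  ultimately show False using bound by simp
qed

text \<open>The left side is a falling factorial whose second factor is already below
  \<open>t\<close>. Absorption peels off the first factor \<open>t\<close>; the other
  \<open>k - 1\<close> factors are bounded by powers of \<open>t - 1\<close>.\<close>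

lemma binomial_fact_less_pow:
  fixes t k :: nat
  assumes "t > 0" "k \<ge> 2"
  shows "(t choose k) * fact k < t ^ k"
proof -
  obtain t' k' where tk: "t = Suc t'" "k = Suc k'" "k' > 0"
    using assms by (metis One_nat_def Suc_le_D gr0_implies_Suc less_eq_Suc_le numeral_2_eq_2 Suc_le_mono)
  have "(t choose k) * fact k = (Suc k' * (Suc t' choose Suc k')) * fact k'"
    by (simp add: tk(1,2) algebra_simps del: binomial_Suc_Suc)
  also have "\<dots> = Suc t' * ((t' choose k') * fact k')"
    by (simp only: Suc_times_binomial mult.assoc)
  also have "\<dots> \<le> Suc t' * t' ^ k'"
    by (intro mult_le_mono2 binomial_fact_pow)
  also have "\<dots> < Suc t' * Suc t' ^ k'"
    using tk(3) by (intro mult_strict_left_mono power_strict_mono) auto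
  finally show ?thesis by (simp add: tk)
qed

text \<open>Rounding down gives only the weak bound \<open>t ^ k * m <= (N choose k) * k!\<close>.
  Strictness comes from \<open>t choose k = 0\<close> if \<open>t < k\<close>, from
  \<open>binomial_fact_less_pow\<close> if \<open>k >= 2\<close>, and for \<open>k = 1\<close> from
  \<open>N < m\<close>, which forces \<open>r < 1\<close> and \<open>t = 0\<close>.\<close>

lemma floor_root_bound:
  fixes N k m :: nat
  defines "r \<equiv> root k (real (N choose k) * fact k / real m)"
  assumes k: "k > 0" and kN: "k \<le> N" and Nm: "N < m"
  defines "t \<equiv> nat \<lfloor>r\<rfloor>"
  shows "t \<le> N" "m * (t choose k) < N choose k" "int (N - t) = \<lceil>real N - r\<rceil>"
proof -
  have m: "m > 1" using k kN Nm by simp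
  have r0: "r \<ge> 0" by (simp add: r_def k)
  have tr: "real t \<le> r" using r0 by (simp add: t_def)
  have rk: "r ^ k = real (N choose k) * fact k / real m" unfolding r_def using k by simp
  have tk: "real t ^ k * m \<le> real (N choose k) * fact k"
  proof -
    have "real t ^ k \<le> r ^ k" using tr by (intro power_mono) auto
    thus ?thesis unfolding rk using m by (simp add: field_simps)
  qed
  have "real t ^ k \<le> real t ^ k * m" using m by (simp add: mult_le_cancel_left1)
  also note tk
  also have "real (N choose k) * fact k \<le> real N ^ k"
    using of_nat_mono[OF binomial_fact_pow[of N k], where 'a = real] by simp
  finally have "real t ^ k \<le> real N ^ k" .
  thus tN: "t \<le> N" using k by (simp add: power_mono_iff)
  have "real (t choose k) * fact k * m < real (N choose k) * fact k"
  proof (cases "t < k")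
    case True
    thus ?thesis using kN by (simp add: binomial_eq_0)
  next
    case False
    have le: "real (t choose k) * fact k \<le> real t ^ k"
      using of_nat_mono[OF binomial_fact_pow[of t k], where 'a = real] by simp
    show ?thesis
    proof (cases "k \<ge> 2")
      case True
      from False True have "(t choose k) * fact k < t ^ k" by (intro binomial_fact_less_pow) auto
      hence "real ((t choose k) * fact k) < real (t ^ k)" by (simp only: of_nat_less_iff)
      hence "real (t choose k) * fact k < real t ^ k" by simp
      thus ?thesis 
        using tk m mult_strict_right_mono[of "real (t choose k) * fact k" "real t ^ k" "real m"]
        by linarith
    next
      case small: False
      hence "k = 1" using k by simp
      moreover have "real N < real m" using Nm by simp
      ultimately have "r < 1" using m by (simp add: r_def)
      hence "t = 0" using r0 by (simp add: t_def)
      thus ?thesis using False k by simp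
    qed
  qed
  hence "real (m * (t choose k)) * fact k < real (N choose k) * fact k" by (simp add: mult_ac)
  hence "real (m * (t choose k)) < real (N choose k)" using mult_less_cancel_right_pos[of "fact k :: real"] by simp
  thus "m * (t choose k) < N choose k" by (simp only: of_nat_less_iff)
  show "int (N - t) = \<lceil>real N - r\<rceil>"
    using tN r0 by (simp add: t_def of_nat_diff) linarith
qed

section \<open>Linear forms and zero loci in homogeneous coordinates\<close>

definition lin_form :: "'a::field \<Rightarrow> 'a \<Rightarrow> 'a \<Rightarrow> 'a \<Rightarrow> 'a ^ 4 \<Rightarrow> 'a" where
  "lin_form a b c d v = a * v$1 + b * v$2 + c * v$3 + d * v$4"

lemma linear_form_iff: "linear_form l \<longleftrightarrow> (\<exists>a b c d. l = lin_form a b c d)"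
proof
  assume "linear_form l"
  then interpret l: Vector_Spaces.linear "(*s)" "(*)" l by (simp add: linear_form_def)
  have "l v = lin_form (l (axis 1 1)) (l (axis 2 1)) (l (axis 3 1)) (l (axis 4 1)) v" for v
  proof -
    have "l v = l (\<Sum>i\<in>UNIV. v$i *s axis i 1)" by (simp only: basis_expansion)
    also have "\<dots> = (\<Sum>i\<in>UNIV. v$i * l (axis i 1))" by (simp only: l.sum l.scale)
    finally show ?thesis by (simp add: sum_4 lin_form_def mult.commute)
  qed
  thus "\<exists>a b c d. l = lin_form a b c d" by blast
next
  assume "\<exists>a b c d. l = lin_form a b c d"
  then obtain a b c d where l: "l = lin_form a b c d" by blast
  show "linear_form l"
    unfolding linear_form_def l
    by unfold_locales (simp_all add: lin_form_def algebra_simps)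
qed

lemma vector_4 [simp]:
  "(vector [x, y, z, w] :: 'a::zero ^ 4)$1 = x"
  "(vector [x, y, z, w] :: 'a::zero ^ 4)$2 = y"
  "(vector [x, y, z, w] :: 'a::zero ^ 4)$3 = z"
  "(vector [x, y, z, w] :: 'a::zero ^ 4)$4 = w"
  unfolding vector_def by simp_all

lemma vec_eq_4: "(v :: 'a ^ 4) = w \<longleftrightarrow> v$1 = w$1 \<and> v$2 = w$2 \<and> v$3 = w$3 \<and> v$4 = w$4"
  by (simp add: vec_eq_iff forall_4)

lemma span_in_proj_points_iff: "vec.span {v} \<in> proj_points \<longleftrightarrow> v \<noteq> (0 :: 'a::field ^ 4)"
proof
  assume "vec.span {v} \<in> proj_points"
  then obtain u where u: "u \<noteq> 0" "vec.span {v} = vec.span {u}" by (auto simp: proj_points_def)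
  show "v \<noteq> 0"
  proof
    assume "v = 0"
    hence "u \<in> {0}" using u(2) vec.span_base[of u "{u}"] by (simp add: vec.span_singleton)
    thus False using u(1) by simp
  qed
qed (auto simp: proj_points_def)

lemma ball_span_singleton: "(\<forall>w\<in>vec.span {v}. Q w) \<longleftrightarrow> (\<forall>k. Q (k *s (v :: 'a::field ^ 4)))"
  by (simp add: vec.span_singleton)

text \<open>\<open>zero_locus\<close> quantifies over every vector of a subspace; homogeneity
  reduces this to one representative.\<close>

lemma span_in_zero_locus_iff:
  fixes v :: "'a::field ^ 4"
  assumes "v \<noteq> 0" and hom: "\<And>k. f v = 0 \<Longrightarrow> f (k *s v) = 0"
  shows "vec.span {v} \<in> zero_locus f \<longleftrightarrow> f v = 0"
proof -
  have "(\<forall>k. f (k *s v) = 0) \<longleftrightarrow> f v = 0"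
    using hom by (metis vec.scale_one)
  thus ?thesis
    using assms(1) by (simp add: zero_locus_def span_in_proj_points_iff ball_span_singleton)
qed

lemma lin_form_scale: "lin_form a b c d (k *s v) = k * lin_form a b c d v"
  by (simp add: lin_form_def algebra_simps)

lemma quadric_form_scale: "quadric_form \<gamma> (k *s v) = k\<^sup>2 * quadric_form \<gamma> v"
  by (simp add: quadric_form_def algebra_simps power2_eq_square)

lemma quadric_diff_scale: "quadric_diff \<gamma> (j *s u) (k *s v) = j * k * quadric_diff \<gamma> u v"
  by (simp add: quadric_diff_def algebra_simps)

lemma span_in_lin_locus_iff:
  "v \<noteq> 0 \<Longrightarrow> vec.span {v} \<in> zero_locus (lin_form a b c d) \<longleftrightarrow> lin_form a b c d v = 0"
  by (rule span_in_zero_locus_iff) (simp_all add: lin_form_scale)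

lemma span_in_quadric_iff:
  "v \<noteq> 0 \<Longrightarrow> vec.span {v} \<in> quadric \<gamma> \<longleftrightarrow> quadric_form \<gamma> v = 0"
  unfolding quadric_def by (rule span_in_zero_locus_iff) (simp_all add: quadric_form_scale)

lemma span_in_tangent_plane_iff:
  "v \<noteq> 0 \<Longrightarrow> vec.span {v} \<in> tangent_plane \<gamma> (vec.span {u}) \<longleftrightarrow> quadric_diff \<gamma> u v = 0"
  by (auto simp: tangent_plane_def span_in_proj_points_iff ball_span_singleton quadric_diff_scale
      dest: spec[of _ 1])

lemma proj_points_cases:
  assumes "P \<in> proj_points"
  obtains v where "v \<noteq> 0" "P = vec.span {v}"
  using assms by (auto simp: proj_points_def)

lemma quadric_subset: "quadric \<gamma> \<subseteq> proj_points" 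
  by (auto simp: quadric_def zero_locus_def)

lemma span_scale_eq:
  fixes v :: "'a::field ^ 4"
  assumes "k \<noteq> 0" shows "vec.span {k *s v} = vec.span {v}"
proof -
  have "w \<in> range (\<lambda>j. j *s (k *s v))" if "w = j *s v" for j w
    using assms that by (intro image_eqI[of _ _ "j / k"]) simp_all
  thus ?thesis unfolding vec.span_singleton by (auto simp: vector_smult_assoc)
qed

section \<open>Arithmetic in characteristic 2 and the quadratic form\<close>

locale hyperbolic_plane =
  fixes \<gamma> :: "'a::{field,finite}"
  assumes char_2: "(1::'a) + 1 = 0"
    and no_root: "\<And>u. u * u + u + \<gamma> \<noteq> 0"
begin

lemma add_self [simp]: "(x::'a) + x = 0"
  using char_2 by (metis distrib_left mult.right_neutral mult_zero_right)

lemma add_left_self [simp]: "(x::'a) + (x + y) = y"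
  by (simp flip: add.assoc)

lemma neg_eq [simp]: "- (x::'a) = x"
  by (simp add: neg_eq_iff_add_eq_0)

lemma diff_eq [simp]: "(x::'a) - y = x + y"
  by (simp only: diff_conv_add_uminus neg_eq)

lemma two_eq_0 [simp]: "(2::'a) = 0"
  using char_2 by (simp only: one_add_one)

lemma add_eq_0_iff [simp]: "(x::'a) + y = 0 \<longleftrightarrow> x = y"
  by (metis add_eq_0_iff neg_eq)

text \<open>The norm of \<open>y + z * \<theta>\<close> from the quadratic extension generated by a
  root \<open>\<theta>\<close> of \<open>t^2 + t + \<gamma>\<close>.\<close>

definition nrm :: "'a \<Rightarrow> 'a \<Rightarrow> 'a" where
  "nrm y z = y * y + y * z + \<gamma> * (z * z)"

lemma nrm_eq_0_iff: "nrm y z = 0 \<longleftrightarrow> y = 0 \<and> z = 0"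
proof
  assume *: "nrm y z = 0"
  have "z = 0"
  proof (rule ccontr)
    assume z: "z \<noteq> 0"
    have "(y / z) * (y / z) + y / z + \<gamma> = nrm y z / (z * z)"
      using z by (simp add: nrm_def add_divide_distrib)
    thus False using no_root[of "y / z"] * by simp
  qed
  thus "y = 0 \<and> z = 0" using * by (simp add: nrm_def)
qed (simp add: nrm_def)

lemma quadric_form_eq: "quadric_form \<gamma> v = v$1 * v$4 + nrm (v$2) (v$3)"
  by (simp add: quadric_form_def nrm_def power2_eq_square algebra_simps)

lemma quadric_diff_eq: "quadric_diff \<gamma> u v = u$4 * v$1 + u$3 * v$2 + u$2 * v$3 + u$1 * v$4"
  by (simp add: quadric_diff_def)

lemma quadric_diff_lin_form: "quadric_diff \<gamma> u = lin_form (u$4) (u$3) (u$2) (u$1)"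
  by (rule ext) (simp add: quadric_diff_eq lin_form_def)

text \<open>The differential is the polar form of the quadratic form. On a line through a point
  \<open>u\<close> of the quadric the form is therefore of degree at most 1 in
  \<open>s\<close>.\<close>

lemma quadric_form_add_scale:
  "quadric_form \<gamma> (v + s *s u) = quadric_form \<gamma> v + s * quadric_diff \<gamma> u v + s * s * quadric_form \<gamma> u"
  by (simp add: quadric_form_eq quadric_diff_eq nrm_def algebra_simps)

lemma quadric_diff_self: "quadric_diff \<gamma> u u = 0"
  by (simp add: quadric_diff_eq algebra_simps)

lemma sqr_eq_iff [simp]: "(x::'a) * x = y * y \<longleftrightarrow> x = y"
proof
  assume "x * x = y * y"
  hence "(x + y) * (x + y) = 0" by (simp add: algebra_simps)
  thus "x = y" by simp
qed simp

text \<open>Squaring is injective in characteristic 2, hence surjective on a finite field.\<close>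

lemma ex_sqrt: "\<exists>r::'a. r * r = x"
proof -
  have "inj (\<lambda>r::'a. r * r)" by (auto intro: injI)
  hence "surj (\<lambda>r::'a. r * r)" by (rule finite_UNIV_inj_surj[OF finite])
  thus ?thesis by (metis surjD)
qed

text \<open>Swapping the arguments makes \<open>(nrt b c, c, b, nrt b c)\<close> a point of the quadric.\<close>

definition nrt :: "'a \<Rightarrow> 'a \<Rightarrow> 'a" where
  "nrt b c = (SOME r. r * r = nrm c b)"

lemma nrt: "nrt b c * nrt b c = nrm c b"
  unfolding nrt_def by (rule someI_ex[OF ex_sqrt])

text \<open>Square roots are unique, so the chosen root inherits homogeneity from
  \<open>nrm\<close>.\<close>

lemma nrt_scale: "nrt (k * b) (k * c) = k * nrt b c"
proof -
  have "nrt (k * b) (k * c) * nrt (k * b) (k * c) = (k * nrt b c) * (k * nrt b c)"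
    using nrt[of b c] by (simp add: nrt nrm_def algebra_simps)
  thus ?thesis by simp
qed

section \<open>Tangent planes and plane sections of the quadric\<close>

lemma tangent_plane_span: "tangent_plane \<gamma> (vec.span {u}) = zero_locus (quadric_diff \<gamma> u)" (is "?A = ?B")
proof -
  have "P \<in> ?A \<longleftrightarrow> P \<in> ?B" if "P \<in> proj_points" for P
  proof -
    from that obtain v where v: "v \<noteq> 0" "P = vec.span {v}" by (rule proj_points_cases)
    thus ?thesis by (simp add: span_in_tangent_plane_iff span_in_lin_locus_iff quadric_diff_lin_form)
  qed
  thus ?thesis by (auto simp: tangent_plane_def zero_locus_def)
qed

text \<open>Subtracting a multiple of \<open>u\<close> from a point \<open>v\<close> of the section
  stays in the tangent plane and on the quadric. Once the first coordinate is 0, anisotropy of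
  \<open>nrm\<close> kills the middle two and the tangent equation kills the last. If
  \<open>u$1 = 0\<close>, then \<open>u\<close> is a multiple of the last basis vector and the
  tangent plane is \<open>x = 0\<close>.\<close>

lemma tangent_section:
  assumes u: "u \<noteq> 0" "quadric_form \<gamma> u = 0"
  shows "quadric \<gamma> \<inter> zero_locus (quadric_diff \<gamma> u) = {vec.span {u}}"
proof (intro equalityI subsetI)
  fix P assume P: "P \<in> quadric \<gamma> \<inter> zero_locus (quadric_diff \<gamma> u)"
  then obtain v where v: "v \<noteq> 0" "P = vec.span {v}"
    using quadric_subset proj_points_cases by blast
  have qv: "quadric_form \<gamma> v = 0" and bv: "quadric_diff \<gamma> u v = 0"
    using P v by (simp_all add: span_in_quadric_iff span_in_lin_locus_iff quadric_diff_lin_form)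
  have "\<exists>k. v = k *s u"
  proof (cases "u$1 = 0")
    case True
    with u have "u$2 = 0" "u$3 = 0" by (simp_all add: quadric_form_eq nrm_eq_0_iff)
    moreover from this True have u4: "u$4 \<noteq> 0" using u(1) by (simp add: vec_eq_4)
    ultimately have v1: "v$1 = 0" using bv True by (simp add: quadric_diff_eq)
    hence "v$2 = 0" "v$3 = 0" using qv by (simp_all add: quadric_form_eq nrm_eq_0_iff)
    with v1 True \<open>u$2 = 0\<close> \<open>u$3 = 0\<close> u4 have "v = (v$4 / u$4) *s u" by (simp add: vec_eq_4)
    thus ?thesis by blast
  next
    case False
    define w where "w = v + (v$1 / u$1) *s u"
    have w1: "w$1 = 0" using False by (simp add: w_def)
    have "quadric_form \<gamma> w = 0" by (simp add: w_def quadric_form_add_scale qv bv u(2))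
    hence w23: "w$2 = 0" "w$3 = 0" using w1 by (simp_all add: quadric_form_eq nrm_eq_0_iff)
    have "quadric_diff \<gamma> u w = quadric_diff \<gamma> u v + (v$1 / u$1) * quadric_diff \<gamma> u u"
      by (simp add: w_def quadric_diff_eq algebra_simps)
    hence "u$1 * w$4 = 0" using w1 w23 by (simp add: bv quadric_diff_self) (simp add: quadric_diff_eq)
    hence "w = 0" using False w1 w23 by (simp add: vec_eq_4)
    hence "v = (v$1 / u$1) *s u" unfolding w_def by (simp add: vec_eq_4)
    thus ?thesis by blast
  qed
  then obtain k where k: "v = k *s u" by blast
  with v(1) have "k \<noteq> 0" by auto
  thus "P \<in> {vec.span {u}}" using v(2) k by (simp add: span_scale_eq)
next
  fix P assume "P \<in> {vec.span {u}}"
  thus "P \<in> quadric \<gamma> \<inter> zero_locus (quadric_diff \<gamma> u)"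
    using u by (simp add: span_in_quadric_iff quadric_diff_lin_form span_in_lin_locus_iff)
       (simp flip: quadric_diff_lin_form add: quadric_diff_self)
qed

text \<open>If the section is one point, the differential there vanishes on the whole plane. It is
  then proportional to the form \<open>l\<close>, and the plane is tangent.\<close>

lemma circle_not_singleton:
  assumes l: "linear_form l" "l \<noteq> (\<lambda>v. 0)" and nt: "\<not> tangent_to_quadric \<gamma> (zero_locus l)"
  shows "quadric \<gamma> \<inter> zero_locus l \<noteq> {P}"
proof
  assume eq: "quadric \<gamma> \<inter> zero_locus l = {P}"
  obtain a b c d where l_eq: "l = lin_form a b c d" using l by (auto simp: linear_form_iff)
  have "P \<in> quadric \<gamma>" using eq by blast
  then obtain u where u: "u \<noteq> 0" "P = vec.span {u}" using quadric_subset proj_points_cases by blast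
  have qu: "quadric_form \<gamma> u = 0" using eq u by (auto simp flip: span_in_quadric_iff)
  have lu: "l u = 0" using eq u by (auto simp: l_eq simp flip: span_in_lin_locus_iff)
  have ladd: "l (v + k *s w) = l v + k * l w" for v w k
    by (simp add: l_eq lin_form_def algebra_simps)
  have Badd: "quadric_diff \<gamma> u (v + k *s w) = quadric_diff \<gamma> u v + k * quadric_diff \<gamma> u w" for v w k
    by (simp add: quadric_diff_eq algebra_simps)
  txt \<open>A line through the only point \<open>u\<close> of the section that is not tangent there meets the quadric
    again.\<close>
  have sub: "quadric_diff \<gamma> u v = 0" if lv: "l v = 0" for v
  proof (rule ccontr)
    assume B: "quadric_diff \<gamma> u v \<noteq> 0"
    \<comment> \<open>The second root on the line: since \<open>u\<close> is on the quadric,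
      \<open>quadric_form\<close> at \<open>v + s *s u\<close> is linear in
      \<open>s\<close>.\<close>
    define s where "s = quadric_form \<gamma> v / quadric_diff \<gamma> u v"
    define w where "w = v + s *s u"
    have qw: "quadric_form \<gamma> w = 0" using B by (simp add: w_def quadric_form_add_scale qu s_def)
    have Bw: "quadric_diff \<gamma> u w \<noteq> 0" using B by (simp add: w_def Badd quadric_diff_self)
    hence "w \<noteq> 0" by (auto simp: quadric_diff_eq)
    moreover have "l w = 0" by (simp add: w_def ladd lv lu)
    ultimately have "vec.span {w} \<in> quadric \<gamma> \<inter> zero_locus l"
      using qw by (simp add: span_in_quadric_iff span_in_lin_locus_iff l_eq)
    hence "vec.span {w} = vec.span {u}" using eq u(2) by blast
    hence "w \<in> vec.span {u}" using vec.span_base[of w "{w}"] by simp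
    then obtain k where "w = k *s u" by (auto simp: vec.span_singleton)
    hence "quadric_diff \<gamma> u w = k * quadric_diff \<gamma> u u" by (simp add: quadric_diff_eq algebra_simps)
    thus False using Bw by (simp add: quadric_diff_self)
  qed
  obtain e where e: "l e \<noteq> 0" using l(2) by blast
  \<comment> \<open>Projecting \<open>v\<close> along \<open>e\<close> into the plane; adding is
    subtracting here.\<close>
  have proportional: "quadric_diff \<gamma> u v = l v / l e * quadric_diff \<gamma> u e" for v
  proof -
    have "l (v + (l v / l e) *s e) = 0" using e by (simp add: ladd)
    from sub[OF this] show ?thesis by (simp add: Badd)
  qed
  have "quadric_diff \<gamma> u e \<noteq> 0"
  proof
    assume "quadric_diff \<gamma> u e = 0"
    hence z: "quadric_diff \<gamma> u v = 0" for v using proportional[of v] by simp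
    have "u = 0"
      using z[of "vector [1,0,0,0]"] z[of "vector [0,1,0,0]"] z[of "vector [0,0,1,0]"] z[of "vector [0,0,0,1]"]
      by (simp add: vec_eq_4 quadric_diff_eq)
    thus False using u(1) by simp
  qed
  hence "quadric_diff \<gamma> u v = 0 \<longleftrightarrow> l v = 0" for v using proportional[of v] e by simp
  hence "zero_locus l = tangent_plane \<gamma> P" by (simp add: u(2) tangent_plane_span zero_locus_def)
  moreover have "P \<in> quadric \<gamma>" by fact
  ultimately show False using nt by (auto simp: tangent_to_quadric_def)
qed


section \<open>The affine chart and the hyperbolic points\<close>

definition aff_vec :: "'a \<Rightarrow> 'a \<Rightarrow> 'a \<Rightarrow> 'a ^ 4" where
  "aff_vec x y z = vector [x, y, z, x + 1]"

definition aff_pt :: "'a \<Rightarrow> 'a \<Rightarrow> 'a \<Rightarrow> ('a ^ 4) set" where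
  "aff_pt x y z = vec.span {aff_vec x y z}"

definition aff_quadric :: "('a \<times> 'a \<times> 'a) set" where
  "aff_quadric = {(x, y, z). x * x + x = nrm y z}"

definition hyp_pt :: "'a \<times> 'a \<times> 'a \<Rightarrow> ('a ^ 4) set set" where
  "hyp_pt = (\<lambda>(x, y, z). {aff_pt x y z, aff_pt (x + 1) y z})"

lemma aff_vec_nonzero: "aff_vec x y z \<noteq> 0"
  by (auto simp: vec_eq_4 aff_vec_def)

text \<open>Proportional vectors with \<open>x + w = 1\<close> are equal, so the chart is
  injective.\<close>

lemma aff_pt_eq_iff: "aff_pt x y z = aff_pt x' y' z' \<longleftrightarrow> x = x' \<and> y = y' \<and> z = z'"
proof
  assume "aff_pt x y z = aff_pt x' y' z'"
  hence "aff_vec x y z \<in> vec.span {aff_vec x' y' z'}"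
    unfolding aff_pt_def using vec.span_base[of "aff_vec x y z"] by blast
  then obtain k where "aff_vec x y z = k *s aff_vec x' y' z'" by (auto simp: vec.span_singleton)
  hence eq: "x = k * x' \<and> y = k * y' \<and> z = k * z' \<and> x + 1 = k * x' + k"
    unfolding vec_eq_4 aff_vec_def vector_4 vector_smult_component distrib_left mult_1_right .
  have "x + 1 = x + k" using eq by metis
  hence "k = 1" by (simp only: add_left_cancel)
  with eq show "x = x' \<and> y = y' \<and> z = z'" by simp
qed simp

lemma aff_pt_in_quadric_iff: "aff_pt x y z \<in> quadric \<gamma> \<longleftrightarrow> (x, y, z) \<in> aff_quadric"
  by (simp add: aff_pt_def span_in_quadric_iff aff_vec_nonzero quadric_form_eq aff_quadric_def)
     (simp add: aff_vec_def algebra_simps)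

lemma aff_pt_in_lin_locus_iff:
  "aff_pt x y z \<in> zero_locus (lin_form a b c a) \<longleftrightarrow> a + b * y + c * z = 0"
proof -
  have "lin_form a b c a (aff_vec x y z) = a + b * y + c * z"
    by (simp add: lin_form_def aff_vec_def algebra_simps)
  thus ?thesis by (simp only: aff_pt_def span_in_lin_locus_iff[OF aff_vec_nonzero])
qed

lemma star_span: "star (vec.span {v}) = vec.span {swap_xw v}"
proof -
  have "swap_xw (k *s v) = k *s swap_xw v" for k by (simp add: swap_xw_def vec_eq_4)
  thus ?thesis by (simp add: star_def vec.span_singleton image_image)
qed

lemma star_aff_pt: "star (aff_pt x y z) = aff_pt (x + 1) y z"
  by (simp add: aff_pt_def star_span) (simp add: aff_vec_def swap_xw_def add.assoc)

lemma base_circle_eq: "base_circle \<gamma> = quadric \<gamma> \<inter> zero_locus (lin_form 1 0 0 1)"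
proof -
  have "(\<lambda>v::'a^4. v$1 + v$4) = lin_form 1 0 0 1" by (rule ext) (simp add: lin_form_def)
  thus ?thesis by (simp only: base_circle_def)
qed

text \<open>The base circle is the part of the quadric at infinity: elsewhere \<open>x + w\<close>
  is nonzero and can be scaled to 1.\<close>

lemma quadric_minus_base_circle:
  "quadric \<gamma> - base_circle \<gamma> = (\<lambda>(x, y, z). aff_pt x y z) ` aff_quadric"
proof (intro equalityI subsetI)
  fix P assume P: "P \<in> quadric \<gamma> - base_circle \<gamma>"
  then obtain v where v: "v \<noteq> 0" "P = vec.span {v}"
    using quadric_subset proj_points_cases by blast
  define s where "s = v$1 + v$4"
  have s: "s \<noteq> 0"
    using P v by (simp add: base_circle_eq span_in_lin_locus_iff) (simp add: lin_form_def s_def)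
  define w where "w = (1 / s) *s v"
  have Pw: "P = vec.span {w}" using s by (simp add: w_def span_scale_eq v)
  have "w$1 + w$4 = s / s" by (simp add: w_def s_def add_divide_distrib del: divide_self_if)
  hence "w$1 + (w$1 + w$4) = w$1 + 1" using s by simp
  hence "w$4 = w$1 + 1" by simp
  hence "w = aff_vec (w$1) (w$2) (w$3)" by (simp add: aff_vec_def vec_eq_4)
  hence Pa: "P = aff_pt (w$1) (w$2) (w$3)" using Pw by (simp add: aff_pt_def)
  moreover have "(w$1, w$2, w$3) \<in> aff_quadric" using P Pa by (simp add: aff_pt_in_quadric_iff)
  ultimately show "P \<in> (\<lambda>(x, y, z). aff_pt x y z) ` aff_quadric" by (auto intro: rev_image_eqI)
next
  fix P assume "P \<in> (\<lambda>(x, y, z). aff_pt x y z) ` aff_quadric"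
  thus "P \<in> quadric \<gamma> - base_circle \<gamma>"
    by (auto simp: aff_pt_in_quadric_iff base_circle_eq aff_pt_in_lin_locus_iff)
qed

lemma hyp_points_eq: "hyp_points \<gamma> = hyp_pt ` aff_quadric"
  unfolding hyp_points_def quadric_minus_base_circle
  by (auto simp: hyp_pt_def star_aff_pt intro!: rev_image_eqI)

lemma aff_quadric_shift: "(x + 1, y, z) \<in> aff_quadric \<longleftrightarrow> (x, y, z) \<in> aff_quadric"
  by (simp add: aff_quadric_def algebra_simps)

lemma hyp_pt_eq_iff:
  "hyp_pt s = hyp_pt (x, y, z) \<longleftrightarrow> s \<in> {(x, y, z), (x + 1, y, z)}"
  by (cases s) (auto simp: hyp_pt_def doubleton_eq_iff aff_pt_eq_iff add.assoc)

lemma hyp_pt_fibre: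
  assumes "p \<in> hyp_points \<gamma>"
  shows "card {s \<in> aff_quadric. hyp_pt s = p} = 2"
proof -
  obtain x y z where p: "p = hyp_pt (x, y, z)" "(x, y, z) \<in> aff_quadric"
    using assms by (auto simp: hyp_points_eq)
  have "{s \<in> aff_quadric. hyp_pt s = p} = {(x, y, z), (x + 1, y, z)}"
    using p by (auto simp: hyp_pt_eq_iff aff_quadric_shift)
  thus ?thesis by simp
qed

text \<open>\<open>hyp_pt\<close> is two-to-one, so hyperbolic points are counted through affine
  solutions.\<close>

lemma card_hyp_pt_vimage:
  assumes "A \<subseteq> hyp_points \<gamma>"
  shows "card {s \<in> aff_quadric. hyp_pt s \<in> A} = 2 * card A"
proof -
  have "{s \<in> aff_quadric. hyp_pt s \<in> A} = (\<Union>p\<in>A. {s \<in> aff_quadric. hyp_pt s = p})" by blast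
  hence "card {s \<in> aff_quadric. hyp_pt s \<in> A} = (\<Sum>p\<in>A. card {s \<in> aff_quadric. hyp_pt s = p})"
    by (simp only:) (rule card_UN_disjoint, auto)
  also have "\<dots> = (\<Sum>p\<in>A. 2)" using assms hyp_pt_fibre by (intro sum.cong) auto
  finally show ?thesis by simp
qed

text \<open>The substitution \<open>u = x + y\<close> makes the equation linear in \<open>y\<close> with leading coefficient \<open>1 + z\<close>.\<close>

lemma aff_quadric_iff:
  "(u + y, y, z) \<in> aff_quadric \<longleftrightarrow> u * u + u + \<gamma> * (z * z) = y * (1 + z)"
proof -
  have "(u + y) * (u + y) + (u + y) + nrm y z = u * u + u + \<gamma> * (z * z) + y * (1 + z)"
    by (simp add: nrm_def algebra_simps)
  hence "(u + y) * (u + y) + (u + y) + nrm y z = 0 \<longleftrightarrow> u * u + u + \<gamma> * (z * z) + y * (1 + z) = 0"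
    by (simp only:)
  thus ?thesis by (simp only: aff_quadric_def mem_Collect_eq prod.case add_eq_0_iff)
qed

text \<open>At \<open>z = 1\<close> division by zero yields \<open>y = 0\<close>, which need not
  solve the equation. Injectivity holds even there, because \<open>u\<close> is the sum of the first
  two components.\<close>

definition aff_param :: "'a \<times> 'a \<Rightarrow> 'a \<times> 'a \<times> 'a" where
  "aff_param = (\<lambda>(u, z). let y = (u * u + u + \<gamma> * (z * z)) / (1 + z) in (u + y, y, z))"

lemma aff_param_in: "z \<noteq> 1 \<Longrightarrow> aff_param (u, z) \<in> aff_quadric"
  by (auto simp: aff_param_def Let_def aff_quadric_iff)

lemma inj_aff_param: "inj aff_param"
  by (rule injI) (auto simp: aff_param_def Let_def)

lemma aff_quadric_eq: "aff_quadric = aff_param ` (UNIV \<times> (UNIV - {1}))"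
proof (intro equalityI subsetI)
  fix s assume s: "s \<in> aff_quadric"
  obtain x y z where xyz: "s = (x, y, z)" by (cases s)
  define u where "u = x + y"
  have su: "s = (u + y, y, z)" by (simp add: xyz u_def add.assoc)
  with s have eq: "u * u + u + \<gamma> * (z * z) = y * (1 + z)" by (simp add: aff_quadric_iff)
  \<comment> \<open>At \<open>z = 1\<close> the right side vanishes and the left side is
    \<open>u^2 + u + \<gamma>\<close>, which has no root.\<close>
  have "z \<noteq> 1" using eq no_root[of u] by auto
  hence "y = (u * u + u + \<gamma> * (z * z)) / (1 + z)" by (auto simp: eq)
  hence "s = aff_param (u, z)" by (simp add: su aff_param_def Let_def)
  thus "s \<in> aff_param ` (UNIV \<times> (UNIV - {1}))" using \<open>z \<noteq> 1\<close> by blast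
qed (auto intro: aff_param_in)

lemma card_hyp_points: "2 * card (hyp_points \<gamma>) = CARD('a) * (CARD('a) - 1)"
proof -
  have "card aff_quadric = CARD('a) * (CARD('a) - 1)"
    unfolding aff_quadric_eq
    by (subst card_image) (auto intro: inj_on_subset[OF inj_aff_param] simp: card_cartesian_product)
  moreover have "{s \<in> aff_quadric. hyp_pt s \<in> hyp_points \<gamma>} = aff_quadric" by (auto simp: hyp_points_eq)
  ultimately show ?thesis using card_hyp_pt_vimage[of "hyp_points \<gamma>"] by simp
qed

section \<open>Invariant planes and the hyperbolic lines\<close>

text \<open>
  The plane \<open>a (x + w) + b y + c z = 0\<close> is tangent iff \<open>a = nrt b c\<close>, so every other one with
  \<open>(b, c) \<noteq> (0, 0)\<close> has a unique multiple with \<open>a = 1 + nrt b c\<close>.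
\<close>

definition sym_plane :: "'a \<Rightarrow> 'a \<Rightarrow> ('a ^ 4) set set" where
  "sym_plane b c = zero_locus (lin_form (1 + nrt b c) b c (1 + nrt b c))"

lemma zero_locus_lin_form_scale:
  "k \<noteq> 0 \<Longrightarrow> zero_locus (lin_form (k * a) (k * b) (k * c) (k * d)) = zero_locus (lin_form a b c d)"
proof -
  assume k: "k \<noteq> 0"
  have "lin_form (k * a) (k * b) (k * c) (k * d) v = k * lin_form a b c d v" for v
    by (simp add: lin_form_def algebra_simps)
  thus ?thesis using k by (simp add: zero_locus_def)
qed

lemma hyp_lines_cases:
  assumes C: "C \<in> hyp_lines \<gamma>"
  obtains b c where "(b, c) \<noteq> (0, 0)" "C = quadric \<gamma> \<inter> sym_plane b c"
proof -
  obtain l where l: "linear_form l" "l \<noteq> (\<lambda>v. 0)" "\<And>v. l (swap_xw v) = l v"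
    "C = quadric \<gamma> \<inter> zero_locus l"
    using C by (auto simp: hyp_lines_def)
  obtain a b c d where l_eq: "l = lin_form a b c d" using l(1) by (auto simp: linear_form_iff)
  have d: "d = a" using l(3)[of "vector [1, 0, 0, 0]"] by (simp add: l_eq lin_form_def swap_xw_def)
  have bc: "(b, c) \<noteq> (0, 0)"
  proof
    assume "(b, c) = (0, 0)"
    hence bc0: "b = 0" "c = 0" by auto
    have "a \<noteq> 0" using l(2) by (auto simp: l_eq d bc0 lin_form_def)
    hence "zero_locus l = zero_locus (lin_form 1 0 0 1)"
      using zero_locus_lin_form_scale[of a 1 0 0 1] by (simp add: l_eq d bc0)
    hence "C = base_circle \<gamma>" by (simp add: l(4) base_circle_eq)
    thus False using C by (simp add: hyp_lines_def)
  qed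
  have "a \<noteq> nrt b c"
  proof
    assume a: "a = nrt b c"
    \<comment> \<open>The would-be point of tangency: \<open>quadric_diff\<close> reverses
      coordinates, so its coefficients at \<open>u\<close> are those of \<open>l\<close>.\<close>
    define u :: "'a ^ 4" where "u = vector [a, c, b, a]"
    have "u \<noteq> 0" using bc by (auto simp: u_def vec_eq_4)
    moreover have "quadric_form \<gamma> u = 0" by (simp add: u_def quadric_form_eq a nrt)
    ultimately have "C = {vec.span {u}}"
      using tangent_section[of u] by (simp add: l(4) l_eq d quadric_diff_lin_form u_def)
    \<comment> \<open>The invariant form \<open>l\<close> may differ from the form \<open>l'\<close>
      that makes \<open>C\<close> a circle. The contradiction is therefore about the point set:
      \<open>C\<close> is a single point, which no nontangent plane cuts out.\<close>
    moreover from C obtain l' where "linear_form l'" "l' \<noteq> (\<lambda>v. 0)"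
      "\<not> tangent_to_quadric \<gamma> (zero_locus l')" "C = quadric \<gamma> \<inter> zero_locus l'"
      by (auto simp: hyp_lines_def circles_def)
    ultimately show False using circle_not_singleton by metis
  qed
  hence ar: "a + nrt b c \<noteq> 0" by simp
  define k where "k = 1 / (a + nrt b c)"
  have k: "k \<noteq> 0" using ar by (simp add: k_def)
  have "k * a + k * nrt b c = k * (a + nrt b c)" by (simp only: distrib_left)
  also have "\<dots> = 1" unfolding k_def times_divide_eq_left mult_1_left by (rule divide_self[OF ar])
  finally have "k * a = 1 + k * nrt b c" by (metis add.commute add_left_self)
  hence ka: "k * a = 1 + nrt (k * b) (k * c)" by (simp add: nrt_scale)
  have "zero_locus l = sym_plane (k * b) (k * c)"
    using zero_locus_lin_form_scale[OF k, of a b c a] by (simp add: sym_plane_def l_eq d ka)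
  thus ?thesis using that[of "k * b" "k * c"] bc k l(4) by auto
qed

text \<open>In the chart the equation of an invariant plane does not involve \<open>x\<close>, so it
  holds at both points of a pair or at neither.\<close>

lemma hyp_pt_subset_iff:
  assumes "(x, y, z) \<in> aff_quadric"
  shows "hyp_pt (x, y, z) \<subseteq> quadric \<gamma> \<inter> sym_plane b c \<longleftrightarrow> 1 + nrt b c + b * y + c * z = 0"
  using assms
  by (simp add: hyp_pt_def sym_plane_def aff_pt_in_lin_locus_iff aff_pt_in_quadric_iff aff_quadric_shift)

text \<open>The field injects into the affine solutions on the plane, and each hyperbolic point
  accounts for two of them.\<close>

lemma card_points_on_line:
  assumes bc: "(b, c) \<noteq> (0, 0)"
  shows "CARD('a) \<le> 2 * card {p \<in> hyp_points \<gamma>. p \<subseteq> quadric \<gamma> \<inter> sym_plane b c}"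
proof -
  define A where "A = {p \<in> hyp_points \<gamma>. p \<subseteq> quadric \<gamma> \<inter> sym_plane b c}"
  define S where "S = {s \<in> aff_quadric. hyp_pt s \<in> A}"
  define r where "r = nrt b c"
  have S: "(x, y, z) \<in> S \<longleftrightarrow> (x, y, z) \<in> aff_quadric \<and> 1 + r + b * y + c * z = 0" for x y z
    using hyp_pt_subset_iff[of x y z b c]
    by (auto simp: S_def A_def r_def hyp_points_eq)
  have r: "r * r = c * c + c * b + \<gamma> * (b * b)" unfolding r_def nrt nrm_def ..
  have "\<exists>f::'a \<Rightarrow> 'a \<times> 'a \<times> 'a. inj f \<and> range f \<subseteq> S"
  proof (cases "b = 0")
    case True
    hence c: "c \<noteq> 0" and rc: "r = c" using bc r by auto
    \<comment> \<open>For \<open>b = 0\<close> the plane equation fixes \<open>z\<close>; as this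
      value is not 1, \<open>aff_param\<close> gives one solution for each \<open>u\<close>.\<close>
    define z where "z = (1 + c) / c"
    have z: "c * z = 1 + c" using c by (simp add: z_def)
    hence z1: "z \<noteq> 1" by auto
    have "inj (\<lambda>u. aff_param (u, z))" using inj_aff_param by (auto simp: inj_def)
    moreover have "aff_param (u, z) \<in> S" for u
      using aff_param_in[OF z1, of u] by (simp add: aff_param_def Let_def S True rc z)
    ultimately show ?thesis by blast
  next
    case b: False
    txt \<open>The substitution \<open>t = x + (a + r z) / b\<close> with \<open>a = 1 + r\<close> turns the quadric restricted
      to the plane into \<open>z = b t\<^sup>2 + b t + a\<close>.\<close>
    define Z where "Z t = b * (t * t) + b * t + (1 + r)" for t
    define Y where "Y t = (c * Z t + (1 + r)) / b" for t
    define X where "X t = t + (1 + r + r * Z t) / b" for t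
    have bY: "b * Y t = c * Z t + (1 + r)" and bX: "b * X t = b * t + (1 + r + r * Z t)" for t
      using b by (simp_all only: X_def Y_def distrib_left[of b t] times_divide_eq_right nonzero_mult_div_cancel_left not_False_eq_True)
    have "(X t, Y t, Z t) \<in> S" for t
    proof -
      \<comment> \<open>Multiplying by \<open>b * b\<close> clears denominators: the chain
        eliminates \<open>X t\<close>, recognises \<open>Z t\<close>, replaces \<open>r * r\<close>
        by the norm, and reassembles \<open>Y t\<close>.\<close>
      have "b * b * (X t * X t + X t) = (b * X t) * (b * X t) + b * (b * X t)"
        by (simp add: algebra_simps)
      also have "\<dots> = (b * t + (1 + r + r * Z t)) * (b * t + (1 + r + r * Z t)) + b * (b * t + (1 + r + r * Z t))"
        by (simp only: bX)
      also have "\<dots> = b * (b * (t * t) + b * t + (1 + r)) + b * r * Z t + (1 + r * r) + (r * r) * (Z t * Z t)"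
        by (simp add: algebra_simps)
      also have "\<dots> = b * (1 + r) * Z t + (1 + r * r) + (r * r) * (Z t * Z t)"
        unfolding Z_def[symmetric] by (simp add: algebra_simps)
      also have "\<dots> = b * (1 + r) * Z t + (1 + r * r) + (c * c + c * b + \<gamma> * (b * b)) * (Z t * Z t)"
        by (simp only: r)
      also have "\<dots> = (c * Z t + (1 + r)) * (c * Z t + (1 + r)) + b * (c * Z t + (1 + r)) * Z t + \<gamma> * (b * b) * (Z t * Z t)"
        by (simp add: algebra_simps del: add_eq_0_iff)
      also have "\<dots> = (b * Y t) * (b * Y t) + b * (b * Y t) * Z t + \<gamma> * (b * b) * (Z t * Z t)"
        by (simp only: bY)
      also have "\<dots> = b * b * nrm (Y t) (Z t)" by (simp add: nrm_def algebra_simps)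
      finally have "X t * X t + X t = nrm (Y t) (Z t)" using b by simp
      moreover have "1 + r + b * Y t + c * Z t = 0" by (simp add: bY algebra_simps)
      ultimately show ?thesis by (simp add: S aff_quadric_def)
    qed
    \<comment> \<open>\<open>t\<close> is recovered from \<open>X t\<close> and
      \<open>Z t\<close>.\<close>
    moreover have "inj (\<lambda>t. (X t, Y t, Z t))"
      by (rule injI) (auto simp: X_def)
    ultimately show ?thesis by blast
  qed
  then obtain f :: "'a \<Rightarrow> 'a \<times> 'a \<times> 'a" where "inj f" "range f \<subseteq> S" by blast
  hence "CARD('a) \<le> card S" by (metis card_image card_mono finite)
  also have "\<dots> = 2 * card A" unfolding S_def by (rule card_hyp_pt_vimage) (auto simp: A_def)
  finally show ?thesis unfolding A_def .
qed

end

section \<open>Assembling the blocking set\<close>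

theorem theorem6p4:
  fixes \<gamma> :: "'a::{field,finite}" and q :: nat
  assumes "primepow q" and "even q" and "CARD('a) = q"
    and "irreducible [:\<gamma>, 1, 1:]"
  shows "\<exists>X. blocking_set \<gamma> X \<and>
    int (card X) \<le>
      \<lceil>real q * (real q - 1) / 2
        - root (q div 2)
            (real ((q * (q - 1) div 2) choose (q div 2)) * fact (q div 2) / (real q ^ 2 - 1))\<rceil>"
proof -
  obtain p m where p: "prime p" "q = p ^ m" using assms(1) by (auto simp: primepow_def)
  have "p = 2" using p assms(2) by (metis even_power primes_dvd_imp_eq two_is_prime_nat)
  have q2: "q \<ge> 2" using primepow_gt_Suc_0[OF assms(1)] by simp
  interpret hyperbolic_plane \<gamma>
  proof
    have "of_nat q = (0::'a)"
      using CHAR_dvd_CARD[where 'a = 'a] assms(3) by (simp add: of_nat_eq_0_iff_char_dvd)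
    hence "(2::'a) = 0" using p(2) \<open>p = 2\<close> by simp
    thus "(1::'a) + 1 = 0" by simp
  next
    fix u :: 'a
    show "u * u + u + \<gamma> \<noteq> 0"
    proof
      assume "u * u + u + \<gamma> = 0"
      \<comment> \<open>The two roots sum to \<open>-1\<close>, so a root \<open>u\<close> comes
        with the root \<open>- u - 1\<close>.\<close>
      hence "[:\<gamma>, 1, 1:] = [:- u, 1:] * [:u + 1, 1:]"
        by (simp add: algebra_simps eq_neg_iff_add_eq_0)
      from irreducibleD[OF assms(4) this] show False by (simp add: is_unit_pCons_iff)
    qed
  qed
  define n k M where "n = q * (q - 1) div 2" and "k = q div 2" and "M = q\<^sup>2 - 1"
  define r where "r = root k (real (n choose k) * fact k / real M)"
  define t where "t = nat \<lfloor>r\<rfloor>"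
  have k0: "k > 0" using q2 by (simp add: k_def)
  have n2: "2 * n = q * (q - 1)" using assms(2) by (simp add: n_def)
  have kn: "k \<le> n" unfolding k_def n_def using q2 by (intro div_le_mono) simp
  \<comment> \<open>This yields \<open>n < M\<close>, which \<open>floor_root_bound\<close> relies
    on when \<open>q = 2\<close>, where \<open>k = 1\<close>.\<close>
  have "q * (q - 1) < 2 * (q\<^sup>2 - 1)"
  proof -
    obtain j where "q = Suc (Suc j)" using q2 by (metis add_2_eq_Suc le_Suc_ex)
    thus ?thesis by (simp add: power2_eq_square)
  qed
  hence nM: "n < M" using n2 by (simp add: M_def)
  note t = floor_root_bound[OF k0 kn nM, folded r_def, folded t_def]
  have card_points: "card (hyp_points \<gamma>) = n" using card_hyp_points n2 assms(3) by simp
  \<comment> \<open>Lines are indexed by the \<open>q^2 - 1\<close> plane parameters;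
    \<open>hyp_lines_cases\<close> ensures that every line occurs.\<close>
  define I where "I = (UNIV :: ('a \<times> 'a) set) - {(0, 0)}"
  define L where "L = (\<lambda>(b, c). {p \<in> hyp_points \<gamma>. p \<subseteq> quadric \<gamma> \<inter> sym_plane b c})"
  have cardI: "card I = M"
    by (simp add: I_def M_def card_Diff_subset card_prod assms(3) power2_eq_square flip: UNIV_Times_UNIV)
  have "\<exists>X\<subseteq>hyp_points \<gamma>. card X = card (hyp_points \<gamma>) - t \<and> (\<forall>i\<in>I. X \<inter> L i \<noteq> {})"
  proof (rule blocking_set_exists)
    fix i assume "i \<in> I"
    thus "k \<le> card (L i)"
      using card_points_on_line[of "fst i" "snd i"] by (cases i) (auto simp: I_def L_def k_def assms(3))
  qed (use t card_points cardI in \<open>auto simp: L_def\<close>)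
  then obtain X where X: "X \<subseteq> hyp_points \<gamma>" "card X = n - t" "\<And>i. i \<in> I \<Longrightarrow> X \<inter> L i \<noteq> {}"
    by (auto simp: card_points)
  have "blocking_set \<gamma> X"
    unfolding blocking_set_def
  proof (intro conjI ballI X(1))
    fix C assume "C \<in> hyp_lines \<gamma>"
    then obtain b c where "(b, c) \<in> I" "C = quadric \<gamma> \<inter> sym_plane b c"
      by (rule hyp_lines_cases) (simp add: I_def)
    thus "\<exists>p\<in>X. p \<subseteq> C" using X(3)[of "(b, c)"] by (auto simp: L_def)
  qed
  moreover have "int (card X) = \<lceil>real n - r\<rceil>" using X(2) t(3) by simp
  moreover have "real n = real q * (real q - 1) / 2"
    using arg_cong[OF n2, of real] q2 by (simp add: of_nat_diff)
  moreover have "r = root (q div 2)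
      (real ((q * (q - 1) div 2) choose (q div 2)) * fact (q div 2) / (real q ^ 2 - 1))"
    using q2 by (simp add: r_def n_def k_def M_def of_nat_diff)
  ultimately show ?thesis by (metis order_refl)
qed

end
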